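(* Let $q$ be a prime power, $n\geq 5$, and $I,J$ integers with $0<I<J<n$, $I<n/2$, $I+J\neq n$ and $\gcd(n,J-I)=1$; let $A\in\mathbb{F}_q\setminus\{0\}$. With $a,b,c,P$ as in the context, there exists an $(n-1)$-tuple $Q=(u_1,\dots,u_{n-1})\in\overline{\mathbb{F}_q}^{\,n-1}$ which is a zero of odd multiplicity $m_1$ of the polynomial $ac$ and a zero of multiplicity $m_2$ of $b$, with $2m_2>m_1$. In particular $P$ is absolutely irreducible (irreducible in $\overline{\mathbb{F}_q}[X_0,\dots,X_{n-1}]$).
   Context: Work in $\overline{\mathbb{F}_q}[X_0,\dots,X_{n-1}]$, with indices of variables taken modulo $n$. Let $F_1=\prod_{\ell=0}^{n-1}(X_\ell-X_{\ell+I})$, $F_2=\prod_{\ell=0}^{n-1}(X_\ell-X_{\ell+J})$ and $P=AF_1-F_2$. Define $G,H\in\overline{\mathbb{F}_q}[X_1,\dots,X_{n-1}]$ by $F_1=(X_0-X_I)(X_{n-I}-X_0)G$, $F_2=(X_0-X_J)(X_{n-J}-X_0)H$, so that $P=aX_0^2+bX_0+c$ with $a=H-AG$, $b=AG(X_I+X_{n-I})-H(X_J+X_{n-J})$, $c=HX_JX_{n-J}-AGX_IX_{n-I}$. For a polynomial $p\in\overline{\mathbb{F}_q}[X_1,\dots,X_m]$ and $Q=(u_1,\dots,u_m)\in\overline{\mathbb{F}_q}^m$, write $p(X_1+u_1,\dots,X_m+u_m)=p_k+p_{k+1}+\cdots$ with each $p_i$ zero or homogeneous of degree $i$ and $p_k\neq0$;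 the multiplicity of $p$ at $Q$ is $k$ (a zero of $p$ means multiplicity $\geq1$). *)

theory Defs
  imports
    "HOL-Library.Poly_Mapping"
    "HOL-Number_Theory.Prime_Powers"
    "HOL-Algebra.Algebraic_Closure_Type"
begin

text \<open>Multivariate polynomials over \<open>'a\<close> in the variables \<open>X\<^sub>0, X\<^sub>1, X\<^sub>2, \<dots>\<close>; the keys are exponent
  vectors. The polynomial ring in the variables with index in \<open>V\<close> is the subring \<open>mpolys V\<close>.\<close>

type_synonym 'a mpol = "(nat \<Rightarrow>\<^sub>0 nat) \<Rightarrow>\<^sub>0 'a"

definition Var :: "nat \<Rightarrow> 'a::comm_ring_1 mpol" where
  "Var i = Poly_Mapping.single (Poly_Mapping.single i 1) 1"

definition Const :: "'a \<Rightarrow> 'a::comm_ring_1 mpol" where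
  "Const x = Poly_Mapping.single 0 x"

definition mpolys :: "nat set \<Rightarrow> 'a::comm_ring_1 mpol set" where
  "mpolys V = {p. \<forall>m\<in>Poly_Mapping.keys p. Poly_Mapping.keys m \<subseteq> V}"

definition irreducible_in :: "'a::comm_ring_1 set \<Rightarrow> 'a \<Rightarrow> bool" where
  "irreducible_in S p \<longleftrightarrow> p \<in> S \<and> p \<noteq> 0 \<and> \<not> (\<exists>s\<in>S. p * s = 1) \<and>
     (\<forall>x\<in>S. \<forall>y\<in>S. p = x * y \<longrightarrow> (\<exists>s\<in>S. x * s = 1) \<or> (\<exists>s\<in>S. y * s = 1))"

lemma irreducible_in_UNIV: "irreducible_in UNIV p \<longleftrightarrow> Factorial_Ring.irreducible p"
  by (auto simp: irreducible_in_def Factorial_Ring.irreducible_def dvd_def)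

definition mpol_subst :: "(nat \<Rightarrow> 'a mpol) \<Rightarrow> 'a::comm_ring_1 mpol \<Rightarrow> 'a mpol" where
  "mpol_subst f p = (\<Sum>m\<in>Poly_Mapping.keys p.
     Const (Poly_Mapping.lookup p m) * (\<Prod>i\<in>Poly_Mapping.keys m. f i ^ Poly_Mapping.lookup m i))"

definition translate :: "(nat \<Rightarrow> 'a) \<Rightarrow> 'a::comm_ring_1 mpol \<Rightarrow> 'a mpol" where
  "translate u p = mpol_subst (\<lambda>i. Var i + Const (u i)) p"

definition mon_degree :: "(nat \<Rightarrow>\<^sub>0 nat) \<Rightarrow> nat" where
  "mon_degree m = (\<Sum>i\<in>Poly_Mapping.keys m. Poly_Mapping.lookup m i)"

definition hom_part :: "nat \<Rightarrow> 'a::comm_ring_1 mpol \<Rightarrow> 'a mpol" where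
  "hom_part k p = (\<Sum>m\<in>{m\<in>Poly_Mapping.keys p. mon_degree m = k}.
     Poly_Mapping.single m (Poly_Mapping.lookup p m))"

text \<open>A relation rather than a function, since the zero polynomial has no multiplicity.
  Only the values \<open>u i\<close> at variables occurring in \<open>p\<close> matter.\<close>

definition has_multiplicity :: "'a::comm_ring_1 mpol \<Rightarrow> (nat \<Rightarrow> 'a) \<Rightarrow> nat \<Rightarrow> bool" where
  "has_multiplicity p u k \<longleftrightarrow>
     hom_part k (translate u p) \<noteq> 0 \<and> (\<forall>i<k. hom_part i (translate u p) = 0)"

definition cyc_prod :: "nat \<Rightarrow> nat \<Rightarrow> 'a::comm_ring_1 mpol" where
  "cyc_prod n I = (\<Prod>l\<in>{0..<n}. Var l - Var ((l + I) mod n))"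

text \<open>\<open>cyc_cofactor n I\<close> is \<open>G\<close> and \<open>cyc_cofactor n J\<close> is \<open>H\<close>; existence and uniqueness are
  established in \<open>cyc_cofactor_explicit\<close> below.\<close>

definition cyc_cofactor :: "nat \<Rightarrow> nat \<Rightarrow> 'a::comm_ring_1 mpol" where
  "cyc_cofactor n I = (THE g. g \<in> mpolys {1..n-1} \<and>
     cyc_prod n I = (Var 0 - Var I) * (Var (n - I) - Var 0) * g)"

definition P_poly :: "nat \<Rightarrow> nat \<Rightarrow> nat \<Rightarrow> 'a \<Rightarrow> 'a::comm_ring_1 mpol" where
  "P_poly n I J A = Const A * cyc_prod n I - cyc_prod n J"

definition a_poly :: "nat \<Rightarrow> nat \<Rightarrow> nat \<Rightarrow> 'a \<Rightarrow> 'a::comm_ring_1 mpol" where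
  "a_poly n I J A = cyc_cofactor n J - Const A * cyc_cofactor n I"

definition b_poly :: "nat \<Rightarrow> nat \<Rightarrow> nat \<Rightarrow> 'a \<Rightarrow> 'a::comm_ring_1 mpol" where
  "b_poly n I J A = Const A * cyc_cofactor n I * (Var I + Var (n - I))
                    - cyc_cofactor n J * (Var J + Var (n - J))"

definition c_poly :: "nat \<Rightarrow> nat \<Rightarrow> nat \<Rightarrow> 'a \<Rightarrow> 'a::comm_ring_1 mpol" where
  "c_poly n I J A = cyc_cofactor n J * Var J * Var (n - J)
                    - Const A * cyc_cofactor n I * Var I * Var (n - I)"

lemma mpolys_1: "1 \<in> mpolys V"
  by (auto simp: mpolys_def)

lemma mpolys_diff: "p \<in> mpolys V \<Longrightarrow> q \<in> mpolys V \<Longrightarrow> p - q \<in> mpolys V"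
  using keys_diff[of p q] by (fastforce simp: mpolys_def)

lemma mpolys_mult: assumes "p \<in> mpolys V" "q \<in> mpolys V" shows "p * q \<in> mpolys V"
  unfolding mpolys_def
proof safe
  fix m i assume m: "m \<in> Poly_Mapping.keys (p * q)" and i: "i \<in> Poly_Mapping.keys m"
  obtain m1 m2 where "m = m1 + m2" "m1 \<in> Poly_Mapping.keys p" "m2 \<in> Poly_Mapping.keys q"
    using m keys_mult[of p q] by blast
  then show "i \<in> V"
    using i assms Poly_Mapping.keys_add[of m1 m2] by (fastforce simp: mpolys_def)
qed

lemma mpolys_prod: "(\<And>l. l \<in> L \<Longrightarrow> f l \<in> mpolys V) \<Longrightarrow> prod f L \<in> mpolys V"
  by (induction L rule: infinite_finite_induct) (auto intro: mpolys_mult mpolys_1)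

lemma Var_in_mpolys: "i \<in> V \<Longrightarrow> Var i \<in> mpolys V"
  by (auto simp: Var_def mpolys_def split: if_splits)

lemma Var_eq_iff: "(Var i :: 'a::comm_ring_1 mpol) = Var j \<longleftrightarrow> i = j"
proof
  assume "(Var i :: 'a mpol) = Var j"
  then have "Poly_Mapping.keys (Var i :: 'a mpol) = Poly_Mapping.keys (Var j :: 'a mpol)" by simp
  then have "Poly_Mapping.single i (1::nat) = Poly_Mapping.single j 1" by (simp add: Var_def)
  then have "Poly_Mapping.keys (Poly_Mapping.single i (1::nat)) =
      Poly_Mapping.keys (Poly_Mapping.single j (1::nat))"
    by (rule arg_cong)
  then show "i = j" by simp
qed simp

lemma cyc_cofactor_explicit:
  fixes n I :: nat
  defines "g \<equiv> \<Prod>l\<in>{1..<n} - {n - I}. (Var l - Var ((l + I) mod n) :: 'a::idom mpol)"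
  assumes "0 < I" "I < n"
  shows "g \<in> mpolys {1..n-1}"
    and "cyc_prod n I = (Var 0 - Var I) * (Var (n - I) - Var 0) * g"
    and "cyc_cofactor n I = g"
proof -
  show g: "g \<in> mpolys {1..n-1}"
    unfolding g_def
  proof (rule mpolys_prod)
    fix l assume l: "l \<in> {1..<n} - {n - I}"
    have "(l + I) mod n \<noteq> 0"
    proof
      assume "(l + I) mod n = 0"
      then have "n dvd l + I" by auto
      then obtain k where k: "l + I = n * k" by (auto simp: dvd_def)
      have "k = 1"
      proof -
        have "l + I < n * 2" using l assms(2,3) by auto
        then have "n * k < n * 2" unfolding k .
        then have "k < 2" by simp
        moreover have "k \<noteq> 0" using k assms by (intro notI) auto
        ultimately show ?thesis by simp
      qed
      then show False using k l by auto
    qed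
    moreover have "(l + I) mod n \<le> n - 1"
      using mod_less_divisor[of n "l + I"] assms(2,3) by linarith
    ultimately show "Var l - Var ((l + I) mod n) \<in> mpolys {1..n-1}"
      using l by (intro mpolys_diff Var_in_mpolys) auto
  qed
  have set: "{0..<n} = insert 0 (insert (n - I) ({1..<n} - {n - I}))"
    using assms by auto
  show eq: "cyc_prod n I = (Var 0 - Var I) * (Var (n - I) - Var 0) * g"
  proof -
    define S where "S = {1..<n} - {n - I}"
    have S: "finite S" "0 \<notin> S" "n - I \<notin> S" by (auto simp: S_def)
    have "n - I \<noteq> 0" using assms(3) by simp
    then show ?thesis
      unfolding cyc_prod_def set g_def S_def[symmetric] using S assms(2,3)
      by (simp add: mult.assoc)
  qed
  have nz: "(Var 0 - Var I) * (Var (n - I) - Var 0) \<noteq> (0 :: 'a mpol)"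
    using assms by (simp add: Var_eq_iff)
  show "cyc_cofactor n I = g"
    unfolding cyc_cofactor_def
  proof (rule the_equality)
    fix h :: "'a mpol"
    assume "h \<in> mpolys {1..n-1} \<and> cyc_prod n I = (Var 0 - Var I) * (Var (n - I) - Var 0) * h"
    then show "h = g" using eq nz mult_left_cancel by metis
  qed (use g eq in auto)
qed

lemma cyc_cofactor:
  assumes "0 < I" "I < n"
  shows "(cyc_cofactor n I :: 'a::idom mpol) \<in> mpolys {1..n-1}"
    and "cyc_prod n I =
      (Var 0 - Var I) * (Var (n - I) - Var 0) * (cyc_cofactor n I :: 'a mpol)"
  using cyc_cofactor_explicit[OF assms, where ?'a = 'a] by simp_all

lemma P_poly_quadratic:
  fixes A :: "'a::idom"
  assumes "0 < I" "I < n" "0 < J" "J < n"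
  shows "P_poly n I J A = a_poly n I J A * Var 0 ^ 2 + b_poly n I J A * Var 0 + c_poly n I J A"
  unfolding P_poly_def a_poly_def b_poly_def c_poly_def
    cyc_cofactor(2)[OF assms(1,2)] cyc_cofactor(2)[OF assms(3,4)]
  by (simp add: algebra_simps power2_eq_square)

end

theory Submission
  imports Defs
begin

text \<open>
  View the two cyclic products as products over the edges \<open>{l, l + I}\<close> resp. \<open>{l, l + J}\<close> of two
  graphs on \<open>\<int>/n\<close>; \<open>G\<close> and \<open>H\<close> collect the edges that avoid the vertex \<open>0\<close>. Suppose \<open>3 J \<noteq> 0\<close> in \<open>\<int>/n\<close>.
  Let \<open>Q\<close> be a point with \<open>X\<^sub>J = X\<^sub>n\<^sub>-\<^sub>J = 0\<close> at which the end points of exactly one \<open>I\<close>-edge avoiding \<open>0\<close>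
  agree, the coordinates being otherwise distinct and nonzero. Then \<open>H(Q) \<noteq> 0\<close> and \<open>G\<close> has a simple
  zero at \<open>Q\<close>, so \<open>a(Q) \<noteq> 0\<close>, \<open>b(Q) = 0\<close> and \<open>c\<close> has a simple zero: \<open>m\<^sub>1 = 1\<close>. If \<open>3 J = 0\<close>, then
  \<open>3 I \<noteq> 0\<close> and \<open>2 J \<noteq> 0\<close>, and the roles of \<open>I\<close> and \<open>J\<close> are exchanged.

  If \<open>P = (\<alpha> X\<^sub>0 + \<beta>) (\<gamma> X\<^sub>0 + \<delta>)\<close>, then \<open>\<alpha>\<close>, \<open>\<gamma>\<close> do not vanish at \<open>Q\<close>, hence \<open>b(Q) = c(Q) = 0\<close> forces
  \<open>\<beta>\<close> and \<open>\<delta>\<close> to vanish both, contradicting the simplicity of the zero of \<open>c = \<beta> \<delta>\<close>. A factor free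
  of \<open>X\<^sub>0\<close> divides \<open>a\<close>, \<open>b\<close> and \<open>c\<close>, which have no common factor.
\<close>

section \<open>Evaluation homomorphisms\<close>

definition mon_eval :: "(nat \<Rightarrow> 'b::comm_ring_1) \<Rightarrow> (nat \<Rightarrow>\<^sub>0 nat) \<Rightarrow> 'b" where
  "mon_eval f m = (\<Prod>i\<in>Poly_Mapping.keys m. f i ^ Poly_Mapping.lookup m i)"

definition mpol_eval ::
    "('a::comm_ring_1 \<Rightarrow> 'b::comm_ring_1) \<Rightarrow> (nat \<Rightarrow> 'b) \<Rightarrow> 'a mpol \<Rightarrow> 'b" where
  "mpol_eval h f p = (\<Sum>m\<in>Poly_Mapping.keys p. h (Poly_Mapping.lookup p m) * mon_eval f m)"

lemma mpol_subst_eq_mpol_eval: "mpol_subst f p = mpol_eval Const f p"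
  by (simp add: mpol_subst_def mpol_eval_def mon_eval_def)

lemma mon_eval_superset:
  assumes "finite S" "Poly_Mapping.keys m \<subseteq> S"
  shows "mon_eval f m = (\<Prod>i\<in>S. f i ^ Poly_Mapping.lookup m i)"
  unfolding mon_eval_def using assms
  by (intro prod.mono_neutral_left) (auto simp: in_keys_iff)

lemma mon_eval_0 [simp]: "mon_eval f 0 = 1"
  by (simp add: mon_eval_def)

lemma mon_eval_add: "mon_eval f (m + m') = mon_eval f m * mon_eval f m'"
proof -
  let ?S = "Poly_Mapping.keys m \<union> Poly_Mapping.keys m'"
  have "mon_eval f (m + m') = (\<Prod>i\<in>?S. f i ^ Poly_Mapping.lookup (m + m') i)"
    using Poly_Mapping.keys_add[of m m'] by (intro mon_eval_superset) auto
  also have "\<dots> = mon_eval f m * mon_eval f m'"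
    by (simp add: lookup_add power_add prod.distrib mon_eval_superset[of ?S])
  finally show ?thesis .
qed

lemma mon_eval_single [simp]: "mon_eval f (Poly_Mapping.single i k) = f i ^ k"
  by (cases "k = 0") (simp_all add: mon_eval_def)

lemma mpol_eq_sum_monomials:
  "(p :: 'a::comm_ring_1 mpol) =
    (\<Sum>m\<in>Poly_Mapping.keys p. Poly_Mapping.single m (Poly_Mapping.lookup p m))"
  by (rule poly_mapping_eqI) (simp add: lookup_sum lookup_single when_def in_keys_iff)

lemma mpol_monomial_induct [case_names zero single add]:
  fixes p :: "'a::comm_ring_1 mpol"
  assumes "P 0" "\<And>m c. P (Poly_Mapping.single m c)" "\<And>p q. P p \<Longrightarrow> P q \<Longrightarrow> P (p + q)"
  shows "P p"
proof -
  have "P (\<Sum>m\<in>S. Poly_Mapping.single m (Poly_Mapping.lookup p m))" if "finite S" for S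
    using that by (induction S rule: finite_induct) (auto intro: assms)
  then show ?thesis
    using mpol_eq_sum_monomials[of p] by (metis finite_keys)
qed

lemma single_eq_Const_mult_mon_eval:
  "Poly_Mapping.single m c = Const c * mon_eval Var (m :: nat \<Rightarrow>\<^sub>0 nat)"
proof -
  have pow: "Var i ^ k = (Poly_Mapping.single (Poly_Mapping.single i k) 1 :: 'a mpol)" for i k
    by (induction k) (simp_all add: Var_def mult_single flip: single_add)
  have "(\<Prod>i\<in>S. Var i ^ Poly_Mapping.lookup m i) =
      (Poly_Mapping.single (\<Sum>i\<in>S. Poly_Mapping.single i (Poly_Mapping.lookup m i)) 1 :: 'a mpol)"
    if "finite S" for S
    using that by (induction S rule: finite_induct) (simp_all add: pow mult_single)
  moreover have "(\<Sum>i\<in>Poly_Mapping.keys m. Poly_Mapping.single i (Poly_Mapping.lookup m i)) = m"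
    by (rule poly_mapping_eqI) (simp add: lookup_sum lookup_single when_def in_keys_iff)
  ultimately have "mon_eval Var m = (Poly_Mapping.single m 1 :: 'a mpol)"
    by (simp add: mon_eval_def)
  then show ?thesis
    by (simp add: Const_def mult_single)
qed

text \<open>Reduces identities between evaluation homomorphisms to constants and variables.\<close>

lemma mpol_induct [case_names Const Var add mult]:
  fixes p :: "'a::comm_ring_1 mpol"
  assumes "\<And>c. P (Const c)" "\<And>i. P (Var i)"
    "\<And>p q. P p \<Longrightarrow> P q \<Longrightarrow> P (p + q)" "\<And>p q. P p \<Longrightarrow> P q \<Longrightarrow> P (p * q)"
  shows "P p"
proof (induction p rule: mpol_monomial_induct)
  case zero
  then show ?case using assms(1)[of 0] by (simp add: Const_def)
next
  case (single m c)
  have one: "P 1" using assms(1)[of 1] by (simp add: Const_def)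
  have pow: "P (Var i ^ k)" for i k
    by (induction k) (auto intro: one assms)
  have "P (\<Prod>i\<in>S. Var i ^ Poly_Mapping.lookup m i)" if "finite S" for S
    using that by (induction S rule: finite_induct) (auto intro: one pow assms)
  then show ?case
    unfolding single_eq_Const_mult_mon_eval by (auto simp: mon_eval_def intro: assms)
qed (use assms in auto)

text \<open>One evaluation map, with varying coefficient embedding \<open>h\<close>, covers
  substitution, values at a point, restriction to a line and reading a polynomial in X_0.\<close>

locale coeff_hom =
  fixes h :: "'a::comm_ring_1 \<Rightarrow> 'b::comm_ring_1"
  assumes hom_0: "h 0 = 0" and hom_1: "h 1 = 1"
    and hom_add: "h (x + y) = h x + h y" and hom_mult: "h (x * y) = h x * h y"
begin

lemma eval_superset:
  assumes "finite S" "Poly_Mapping.keys p \<subseteq> S"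
  shows "mpol_eval h f p = (\<Sum>m\<in>S. h (Poly_Mapping.lookup p m) * mon_eval f m)"
  unfolding mpol_eval_def using assms
  by (intro sum.mono_neutral_left) (auto simp: in_keys_iff hom_0)

lemma eval_zero [simp]: "mpol_eval h f 0 = 0"
  by (simp add: mpol_eval_def)

lemma eval_single [simp]: "mpol_eval h f (Poly_Mapping.single m c) = h c * mon_eval f m"
  by (cases "c = 0") (simp_all add: mpol_eval_def hom_0)

lemma eval_Const [simp]: "mpol_eval h f (Const c) = h c"
  by (simp add: Const_def)

lemma eval_one [simp]: "mpol_eval h f 1 = 1"
  using eval_Const[of f 1] by (simp add: Const_def hom_1)

lemma eval_Var [simp]: "mpol_eval h f (Var i) = f i"
  by (simp add: Var_def hom_1)

lemma eval_add [simp]: "mpol_eval h f (p + q) = mpol_eval h f p + mpol_eval h f q"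
proof -
  let ?S = "Poly_Mapping.keys p \<union> Poly_Mapping.keys q"
  have "mpol_eval h f (p + q) = (\<Sum>m\<in>?S. h (Poly_Mapping.lookup (p + q) m) * mon_eval f m)"
    using Poly_Mapping.keys_add[of p q] by (intro eval_superset) auto
  also have "\<dots> = mpol_eval h f p + mpol_eval h f q"
    by (simp add: lookup_add hom_add sum.distrib eval_superset[of ?S] distrib_right)
  finally show ?thesis .
qed

lemma eval_minus [simp]: "mpol_eval h f (- p) = - mpol_eval h f p"
  using eval_add[of f p "- p"] by (simp add: eq_neg_iff_add_eq_0 add.commute)

lemma eval_diff [simp]: "mpol_eval h f (p - q) = mpol_eval h f p - mpol_eval h f q"
  using eval_add[of f p "- q"] by simp

lemma eval_mult [simp]: "mpol_eval h f (p * q) = mpol_eval h f p * mpol_eval h f q"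
proof (induction p rule: mpol_monomial_induct)
  case (single m c)
  show ?case
    by (induction q rule: mpol_monomial_induct)
      (simp_all add: mult_single mon_eval_add hom_mult algebra_simps)
qed (simp_all add: algebra_simps)

lemma eval_prod [simp]: "mpol_eval h f (prod g S) = (\<Prod>i\<in>S. mpol_eval h f (g i))"
  by (induction S rule: infinite_finite_induct) simp_all

end

interpretation id_hom: coeff_hom "\<lambda>c::'a::comm_ring_1. c"
  by standard simp_all

interpretation Const_hom: coeff_hom "Const :: 'a::comm_ring_1 \<Rightarrow> 'a mpol"
  by standard (simp_all add: Const_def single_add mult_single)

interpretation const_poly_hom: coeff_hom "\<lambda>c::'a::comm_ring_1. [:c:]"
  by standard (simp_all add: one_pCons)

interpretation Const_poly_hom: coeff_hom "\<lambda>c::'a::comm_ring_1. [:Const c:]"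
  by standard (simp_all add: one_pCons Const_hom.hom_0 Const_hom.hom_1 Const_hom.hom_add
      Const_hom.hom_mult)

section \<open>Subrings \<open>mpolys V\<close> and divisibility by X_i - r\<close>

lemma mpol_eval_eq_on_mpolys:
  assumes "p \<in> mpolys V" "\<And>i. i \<in> V \<Longrightarrow> f i = g i"
  shows "mpol_eval h f p = mpol_eval h g p"
  unfolding mpol_eval_def mon_eval_def using assms
  by (intro sum.cong prod.cong refl arg_cong2[where f = "(*)"] arg_cong2[where f = "(^)"])
    (auto simp: mpolys_def)

lemma subst_Var [simp]: "mpol_eval Const Var p = (p :: 'a::comm_ring_1 mpol)"
  by (induction p rule: mpol_induct) simp_all

lemma Const_in_mpolys: "Const c \<in> mpolys V"
  by (auto simp: Const_def mpolys_def split: if_splits)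

lemma mpolys_0: "0 \<in> mpolys V"
  by (simp add: mpolys_def)

lemma mpolys_add: "p \<in> mpolys V \<Longrightarrow> q \<in> mpolys V \<Longrightarrow> p + q \<in> mpolys V"
  using Poly_Mapping.keys_add[of p q] by (fastforce simp: mpolys_def)

text \<open>Setting the variables outside \<open>V\<close> to 0 fixes \<open>x\<close> and carries
  any inverse of \<open>x\<close> into \<open>mpolys V\<close>.\<close>

lemma inverse_in_mpolys:
  fixes x :: "'a::comm_ring_1 mpol"
  assumes "x \<in> mpolys V" "x dvd 1"
  shows "\<exists>s\<in>mpolys V. x * s = 1"
proof -
  obtain s where s: "1 = x * s" using assms(2) by (auto simp: dvd_def)
  define f :: "nat \<Rightarrow> 'a mpol" where "f i = (if i \<in> V then Var i else 0)" for i
  have "mpol_eval Const f x = mpol_eval Const Var x"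
    by (rule mpol_eval_eq_on_mpolys[OF assms(1)]) (simp add: f_def)
  moreover have "mpol_eval Const f p \<in> mpolys V" for p
    by (induction p rule: mpol_induct)
      (auto simp: f_def Const_in_mpolys Var_in_mpolys mpolys_0 mpolys_add mpolys_mult)
  ultimately show ?thesis
    using arg_cong[OF s, of "mpol_eval Const f"] by auto
qed

lemma dvd_diff_subst: "(Var i - r) dvd p - mpol_eval Const (Var(i := r)) p"
proof (induction p rule: mpol_induct)
  case (add p q)
  have "p + q - mpol_eval Const (Var(i := r)) (p + q) =
      (p - mpol_eval Const (Var(i := r)) p) + (q - mpol_eval Const (Var(i := r)) q)"
    by simp
  then show ?case using add by (metis dvd_add)
next
  case (mult p q)
  let ?s = "mpol_eval Const (Var(i := r))"
  have "p * q - ?s (p * q) = (p - ?s p) * q + ?s p * (q - ?s q)"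
    by (simp add: algebra_simps)
  then show ?case using mult by (metis dvd_add dvd_mult dvd_mult2)
qed auto

text \<open>Factor theorem in X_i: as \<open>r\<close> is free of X_i, the substitution fixes
  \<open>r\<close> and so kills X_i - r; the converse is \<open>dvd_diff_subst\<close>.\<close>

lemma dvd_iff_subst_eq_0:
  assumes "r \<in> mpolys (- {i})"
  shows "(Var i - r) dvd p \<longleftrightarrow> mpol_eval Const (Var(i := r)) p = 0"
proof
  have "mpol_eval Const (Var(i := r)) r = mpol_eval Const Var r"
    by (rule mpol_eval_eq_on_mpolys[OF assms]) auto
  then have "mpol_eval Const (Var(i := r)) (Var i - r) = 0" by simp
  then show "mpol_eval Const (Var(i := r)) p = 0" if "(Var i - r) dvd p"
    using that by (auto simp: dvd_def)
  show "(Var i - r) dvd p" if "mpol_eval Const (Var(i := r)) p = 0"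
    using dvd_diff_subst[of i r p] that by simp
qed

section \<open>Multiplicities\<close>

text \<open>\<open>line u v p\<close> is the univariate polynomial \<open>p(u + t v)\<close> in \<open>t\<close>.\<close>

abbreviation line :: "(nat \<Rightarrow> 'a) \<Rightarrow> (nat \<Rightarrow> 'a) \<Rightarrow> 'a::comm_ring_1 mpol \<Rightarrow> 'a poly" where
  "line u v \<equiv> mpol_eval (\<lambda>c. [:c:]) (\<lambda>i. [:u i, v i:])"

lemma coeff_0_line: "Polynomial.coeff (line u v p) 0 = mpol_eval (\<lambda>c. c) u p"
  by (induction p rule: mpol_induct) (simp_all add: coeff_mult)

lemma line_translate: "line u v p = line (\<lambda>_. 0) v (translate u p)"
  unfolding translate_def mpol_subst_eq_mpol_eval
  by (induction p rule: mpol_induct) simp_all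

lemma mpol_eval_translate: "mpol_eval (\<lambda>c. c) (\<lambda>_. 0) (translate u p) = mpol_eval (\<lambda>c. c) u p"
  unfolding translate_def mpol_subst_eq_mpol_eval
  by (induction p rule: mpol_induct) simp_all

lemma lookup_hom_part:
  "Poly_Mapping.lookup (hom_part k p) m = (if mon_degree m = k then Poly_Mapping.lookup p m else 0)"
  by (simp add: hom_part_def lookup_sum lookup_single when_def in_keys_iff)

lemma hom_part_eq_0_iff:
  "hom_part k p = 0 \<longleftrightarrow> (\<forall>m. mon_degree m = k \<longrightarrow> Poly_Mapping.lookup p m = 0)"
  by (auto simp: poly_mapping_eq_iff fun_eq_iff lookup_hom_part)

lemma mon_degree_eq_0_iff: "mon_degree m = 0 \<longleftrightarrow> m = 0"
  by (auto simp: mon_degree_def in_keys_iff poly_mapping_eq_iff fun_eq_iff)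

lemma hom_part_0_translate_eq_0_iff:
  "hom_part 0 (translate u p) = 0 \<longleftrightarrow> mpol_eval (\<lambda>c. c) u p = 0"
proof -
  have "mpol_eval (\<lambda>c. c) (\<lambda>_. 0) p = Poly_Mapping.lookup p 0" for p :: "'a mpol"
  proof (induction p rule: mpol_monomial_induct)
    case (single m c)
    have "mon_eval (\<lambda>_. 0) m = (0::'a)" if "m \<noteq> 0"
    proof -
      have "Poly_Mapping.keys m \<noteq> {}" using that by simp
      then obtain i where "i \<in> Poly_Mapping.keys m" by blast
      then show ?thesis
        unfolding mon_eval_def by (intro prod_zero bexI[of _ i]) (auto simp: in_keys_iff zero_power)
    qed
    then show ?case by (cases "m = 0") (simp_all add: lookup_single)
  qed (simp_all add: lookup_add)
  then show ?thesis
    unfolding mpol_eval_translate[of u p, symmetric] by (simp add: hom_part_eq_0_iff mon_degree_eq_0_iff)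
qed

lemma mon_eval_line_0:
  "mon_eval (\<lambda>i. [:0, v i:]) m = Polynomial.monom (mon_eval v m) (mon_degree m)"
proof -
  have pow: "[:0, c:] ^ k = Polynomial.monom (c ^ k) k" for c :: 'a and k
    by (induction k) (simp_all add: monom_Suc mult_pCons_left smult_monom)
  have "(\<Prod>i\<in>S. [:0, v i:] ^ Poly_Mapping.lookup m i) =
      Polynomial.monom (\<Prod>i\<in>S. v i ^ Poly_Mapping.lookup m i) (\<Sum>i\<in>S. Poly_Mapping.lookup m i)"
    if "finite S" for S
    using that by (induction S rule: finite_induct) (simp_all add: pow mult_monom)
  then show ?thesis by (simp add: mon_eval_def mon_degree_def)
qed

text \<open>The coefficient of t^k in p(u + t v) is the degree k part of the translate, evaluated at
  \<open>v\<close>.\<close>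

lemma coeff_line_eq_0:
  assumes "hom_part k (translate u p) = 0"
  shows "Polynomial.coeff (line u v p) k = 0"
proof -
  let ?p = "translate u p"
  have "Polynomial.coeff (line u v p) k = (\<Sum>m\<in>Poly_Mapping.keys ?p.
      Polynomial.coeff ([:Poly_Mapping.lookup ?p m:] * Polynomial.monom (mon_eval v m) (mon_degree m)) k)"
    unfolding line_translate[of u v p] by (simp add: mpol_eval_def mon_eval_line_0 coeff_sum)
  also have "\<dots> = 0"
  proof (rule sum.neutral, rule ballI)
    fix m
    have "Poly_Mapping.lookup ?p m = 0" if "mon_degree m = k"
      using assms that by (simp add: hom_part_eq_0_iff)
    then show "Polynomial.coeff
        ([:Poly_Mapping.lookup ?p m:] * Polynomial.monom (mon_eval v m) (mon_degree m)) k = 0"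
      by (simp add: smult_monom)
  qed
  finally show ?thesis .
qed

text \<open>A nonzero derivative along a single direction \<open>v\<close> certifies a nonzero
  linear part at \<open>u\<close>.\<close>

lemma has_multiplicity_1I:
  assumes "mpol_eval (\<lambda>c. c) u p = 0" "Polynomial.coeff (line u v p) 1 \<noteq> 0"
  shows "has_multiplicity p u 1"
  using assms coeff_line_eq_0[of 1 u p v] hom_part_0_translate_eq_0_iff[of u p]
  by (auto simp: has_multiplicity_def)

lemma ex_has_multiplicity:
  assumes "p \<noteq> 0" "mpol_eval (\<lambda>c. c) u p = 0"
  shows "\<exists>k\<ge>1. has_multiplicity p u k"
proof -
  \<comment> \<open>Translating back recovers \<open>p\<close>, so translation cannot kill a nonzero
    polynomial.\<close>
  have "mpol_eval Const (\<lambda>i. Var i - Const (u i)) (translate u p) = p"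
    unfolding translate_def mpol_subst_eq_mpol_eval
    by (induction p rule: mpol_induct) simp_all
  then have "translate u p \<noteq> 0" using assms(1) by auto
  then obtain m where "Poly_Mapping.lookup (translate u p) m \<noteq> 0"
    by (auto simp: poly_mapping_eq_iff fun_eq_iff)
  then have ex: "\<exists>k. hom_part k (translate u p) \<noteq> 0"
    by (auto simp: hom_part_eq_0_iff)
  define k where "k = (LEAST k. hom_part k (translate u p) \<noteq> 0)"
  have k: "hom_part k (translate u p) \<noteq> 0" unfolding k_def by (rule LeastI_ex[OF ex])
  moreover have "hom_part i (translate u p) = 0" if "i < k" for i
    using not_less_Least[of i] that unfolding k_def by blast
  moreover have "k \<noteq> 0"
    using k assms(2) hom_part_0_translate_eq_0_iff[of u p] by (intro notI) simp
  ultimately show ?thesis by (intro exI[of _ k]) (auto simp: has_multiplicity_def)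
qed

section \<open>A simple branch point\<close>

lemma mod_add_less:
  fixes k l n :: nat
  assumes "k < n" "l < n"
  shows "(k + l) mod n = (if k + l < n then k + l else k + l - n)"
  using assms
  by (simp add: le_mod_geq)

lemma edge_mod_range:
  fixes l I n :: nat
  assumes "0 < I" "I < n" "l \<in> {1..<n} - {n - I}"
  shows "(l + I) mod n \<in> {1..<n}" "(l + I) mod n \<noteq> l"
  using assms by (auto simp: mod_add_less)

text \<open>The edge \<open>{i, i + I}\<close> found here is contracted at the branch point, where \<open>X\<^sub>J = X\<^sub>n\<^sub>-\<^sub>J = 0\<close>
  as well. If \<open>{J, n - J}\<close> is itself an \<open>I\<close>-edge, it must be the one, since otherwise two factors
  of \<open>G\<close> would vanish.\<close>

lemma ex_contracted_edge:
  fixes n I J :: nat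
  assumes "n \<ge> 5" "0 < I" "I < n" "0 < J" "J < n" "I \<noteq> J" "I + J \<noteq> n" "2 * I \<noteq> n"
    and "\<not> n dvd 3 * J"
  shows "\<exists>i\<in>{1..<n} - {n - I}. {i, (i + I) mod n} = {J, n - J} \<or>
    i \<notin> {J, n - J} \<and> (i + I) mod n \<notin> {J, n - J} \<and>
    (\<forall>l\<in>{1..<n} - {n - I}. {l, (l + I) mod n} \<noteq> {J, n - J})"
proof (cases "\<exists>l\<in>{1..<n} - {n - I}. {l, (l + I) mod n} = {J, n - J}")
  case False
  \<comment> \<open>\<open>x\<close> and \<open>y\<close> are J - I and -J - I modulo n;
    \<open>T\<close> collects the vertices \<open>i\<close> whose edge from i to i + I meets 0, J or
    n - J.\<close>
  define x where "x = (J + (n - I)) mod n"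
  define y where "y = ((n - J) + (n - I)) mod n"
  define T where "T = {0, n - I, J, x, n - J, y}"
  have mod: "(J + I) mod n \<noteq> n - J" "((n - J) + I) mod n \<noteq> J"
    using False assms by (auto simp: doubleton_eq_iff)
  have "card T < n"
  proof (cases "2 * J = n")
    case True
    then have "n - J = J" by linarith
    then have "T = {0, n - I, J, x}" by (auto simp: T_def x_def y_def)
    then show ?thesis
      using card_length[of "[0, n - I, J, x]"] \<open>n \<ge> 5\<close> by simp
  next
    case neq: False
    \<comment> \<open>At most six vertices are forbidden, so only n = 5 and n = 6 could fail. There
      the hypotheses force I = 2 J or I = -2 J modulo n, making {J, n - J} an I-edge.\<close>
    have "n \<noteq> 5"
    proof
      assume "n = 5"
      then have "J \<in> {1,2,3,4}" "I \<in> {1,2,3,4}" using assms by auto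
      then show False using mod assms \<open>n = 5\<close> by auto
    qed
    moreover have "n \<noteq> 6"
    proof
      assume "n = 6"
      then have "J \<in> {1,2,3,4,5}" "I \<in> {1,2,3,4,5}" using assms by auto
      then show False using mod assms neq \<open>n = 6\<close> by auto
    qed
    moreover have "card T \<le> 6"
      using card_length[of "[0, n - I, J, x, n - J, y]"] by (simp add: T_def)
    ultimately show ?thesis using assms by linarith
  qed
  then have "card T < card {0..<n}" by simp
  then have "\<not> {0..<n} \<subseteq> T"
    using card_mono[of T "{0..<n}"] by (auto simp: T_def)
  then obtain i where i: "i < n" "i \<notin> T" by force
  have "i \<in> {1..<n} - {n - I}" "i \<notin> {J, n - J}"
    using i by (auto simp: T_def Suc_le_eq)
  moreover have "((i + I) mod n + (n - I)) mod n = i"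
    using i(1) \<open>I < n\<close> by (subst mod_add_left_eq) simp
  then have "(i + I) mod n \<notin> {J, n - J}"
    using i(2) by (auto simp: T_def x_def y_def)
  ultimately show ?thesis using False by blast
qed blast

text \<open>Stated without an order on \<open>I\<close> and \<open>J\<close>, so that it serves both
  assignments of roles.\<close>

lemma cofactor_simple_zero:
  fixes n I J :: nat
  assumes inf: "infinite (UNIV :: 'k::field set)"
    and n: "n \<ge> 5" and I: "0 < I" "I < n" and J: "0 < J" "J < n"
    and IJ: "I \<noteq> J" "I + J \<noteq> n" and I2: "2 * I \<noteq> n" and J3: "\<not> n dvd 3 * J"
  shows "\<exists>u v :: nat \<Rightarrow> 'k. u J = 0 \<and> u (n - J) = 0 \<and> u I \<noteq> 0 \<and> u (n - I) \<noteq> 0 \<and>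
    mpol_eval (\<lambda>c. c) u (cyc_cofactor n J) \<noteq> 0 \<and> mpol_eval (\<lambda>c. c) u (cyc_cofactor n I) = 0 \<and>
    Polynomial.coeff (line u v (cyc_cofactor n I)) 1 \<noteq> 0"
proof -
  obtain i where i: "i \<in> {1..<n} - {n - I}" and
    alt: "{i, (i + I) mod n} = {J, n - J} \<or> i \<notin> {J, n - J} \<and> (i + I) mod n \<notin> {J, n - J} \<and>
      (\<forall>l\<in>{1..<n} - {n - I}. {l, (l + I) mod n} \<noteq> {J, n - J})"
    using ex_contracted_edge[OF n I J IJ I2 J3] by blast
  define i' where "i' = (i + I) mod n"
  have i': "i' \<in> {1..<n}" "i' \<noteq> i"
    using edge_mod_range[OF I i] by (simp_all add: i'_def)
  obtain w0 :: "nat \<Rightarrow> 'k" where w0: "inj w0"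
    using infinite_countable_subset[OF inf] by blast
  \<comment> \<open>\<open>r\<close> labels coordinates: equal labels give equal values, and label 0
    gives the value 0. Among nonzero vertices, only {J, n - J} and {i, i'} are merged.\<close>
  define r where "r k = (if k \<in> {J, n - J} then 0 else if k = i' then i else k)" for k
  define u where "u k = w0 (r k) - w0 0" for k
  \<comment> \<open>Moving X_i alone turns the contracted factor X_i - X_i' into t.\<close>
  define v :: "nat \<Rightarrow> 'k" where "v k = (if k = i then 1 else 0)" for k
  have u_eq: "u k = u l \<longleftrightarrow> r k = r l" for k l
    using w0 by (auto simp: u_def inj_eq)
  have u_0: "u k = 0 \<longleftrightarrow> r k = 0" for k
    using w0 by (auto simp: u_def inj_eq)
  have r_eq: "{k, l} = {J, n - J} \<or> {k, l} = {i, i'}"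
    if "r k = r l" "k \<noteq> l" "k \<in> {1..<n}" "l \<in> {1..<n}" for k l
    using that alt i unfolding i'_def[symmetric] r_def by (auto split: if_splits)
  have "u I \<noteq> 0" "u (n - I) \<noteq> 0"
    using I J IJ i by (auto simp: u_0 r_def)
  moreover have "u J = 0" "u (n - J) = 0"
    by (simp_all add: u_0 r_def)
  moreover have "mpol_eval (\<lambda>c. c) u (cyc_cofactor n J) \<noteq> 0"
  proof -
    have "u l \<noteq> u ((l + J) mod n)" if l: "l \<in> {1..<n} - {n - J}" for l
    proof
      assume "u l = u ((l + J) mod n)"
      then have "{l, (l + J) mod n} = {J, n - J} \<or> {l, (l + J) mod n} = {i, i'}"
        using r_eq[of l "(l + J) mod n"] edge_mod_range[OF J l] l by (auto simp: u_eq)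
      then show False
      proof
        assume "{l, (l + J) mod n} = {J, n - J}"
        \<comment> \<open>The start l = n - J is excluded, so l = J and 2 J = -J modulo n, that is,
          3 J = 0.\<close>
        then have "(J + J) mod n = n - J" using l by (auto simp: doubleton_eq_iff)
        then have "3 * J = n \<or> 3 * J = 2 * n" using J by (auto simp: mod_add_less split: if_splits)
        then show False using J3 by auto
      next
        assume "{l, (l + J) mod n} = {i, i'}"
        \<comment> \<open>An edge of both graphs would give J = I or J = -I modulo n.\<close>
        then have "(i + J) mod n = (i + I) mod n \<or> ((i + I) mod n + J) mod n = i"
          by (auto simp: doubleton_eq_iff i'_def)
        then show False
          using i I J IJ i' by (auto simp: mod_add_less i'_def split: if_splits)
      qed
    qed
    then show ?thesis
      unfolding cyc_cofactor_explicit(3)[OF J] by (simp del: One_nat_def)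
  qed
  moreover have "mpol_eval (\<lambda>c. c) u (cyc_cofactor n I) = 0 \<and>
    Polynomial.coeff (line u v (cyc_cofactor n I)) 1 \<noteq> 0"
  proof -
    define S where "S = {1..<n} - {n - I} - {i}"
    define R where "R = (\<Prod>l\<in>S. Var l - Var ((l + I) mod n) :: 'k mpol)"
    have "{1..<n} - {n - I} = insert i S" "finite S" "i \<notin> S"
      using i by (auto simp: S_def)
    then have G: "cyc_cofactor n I = (Var i - Var i') * R"
      unfolding cyc_cofactor_explicit(3)[OF I] by (simp add: R_def i'_def)
    have "u l \<noteq> u ((l + I) mod n)" if l: "l \<in> S" for l
    proof
      have l': "l \<in> {1..<n} - {n - I}" "l \<noteq> i" using l by (auto simp: S_def)
      assume "u l = u ((l + I) mod n)"
      then have "{l, (l + I) mod n} = {J, n - J} \<or> {l, (l + I) mod n} = {i, i'}"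
        using r_eq[of l "(l + I) mod n"] edge_mod_range[OF I l'(1)] l' by (auto simp: u_eq)
      then have "{l, (l + I) mod n} = {i, i'}"
        using alt l'(1) unfolding i'_def by blast
      \<comment> \<open>Since \<open>l\<close> differs from \<open>i\<close>, this is the same edge
        read from its other end, so 2 I = 0 modulo n.\<close>
      then have "((i + I) mod n + I) mod n = i"
        using l' by (auto simp: doubleton_eq_iff i'_def)
      then show False
        using i I I2 by (auto simp: mod_add_less split: if_splits)
    qed
    then have R: "mpol_eval (\<lambda>c. c) u R \<noteq> 0"
      by (simp add: R_def S_def del: One_nat_def)
    have ui: "u i = u i'"
      using alt i'(2) unfolding i'_def[symmetric] by (auto simp: u_eq r_def)
    then have "line u v (cyc_cofactor n I) = [:0, 1:] * line u v R"
      using i' by (simp add: G v_def)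
    then have "Polynomial.coeff (line u v (cyc_cofactor n I)) 1 = mpol_eval (\<lambda>c. c) u R"
      by (simp add: coeff_0_line)
    then show ?thesis using R ui by (simp add: G)
  qed
  ultimately show ?thesis by blast
qed

lemma coeff_1_mult:
  "Polynomial.coeff (p * q) 1 =
    Polynomial.coeff p 0 * Polynomial.coeff q 1 + Polynomial.coeff p 1 * Polynomial.coeff q 0"
  by (simp add: coeff_mult)

lemma ex_branch_point:
  fixes A :: "'k::field"
  assumes inf: "infinite (UNIV :: 'k set)" and n: "n \<ge> 5"
    and IJ: "0 < I" "I < J" "J < n" "2 * I < n" "I + J \<noteq> n" and A: "A \<noteq> 0"
  shows "\<exists>u v. mpol_eval (\<lambda>c. c) u (a_poly n I J A) \<noteq> 0 \<and>
    mpol_eval (\<lambda>c. c) u (b_poly n I J A) = 0 \<and> mpol_eval (\<lambda>c. c) u (c_poly n I J A) = 0 \<and>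
    Polynomial.coeff (line u v (c_poly n I J A)) 1 \<noteq> 0"
proof (cases "n dvd 3 * J")
  case False
  obtain u v :: "nat \<Rightarrow> 'k" where uv: "u J = 0" "u (n - J) = 0" "u I \<noteq> 0" "u (n - I) \<noteq> 0"
    "mpol_eval (\<lambda>c. c) u (cyc_cofactor n J) \<noteq> 0" "mpol_eval (\<lambda>c. c) u (cyc_cofactor n I) = 0"
    "Polynomial.coeff (line u v (cyc_cofactor n I)) 1 \<noteq> 0"
    using cofactor_simple_zero[OF inf n, of I J] IJ False by auto
  \<comment> \<open>Along the line, H X_J X_(n-J) vanishes to second order; only A G X_I X_(n-I)
    contributes, through the simple zero of G.\<close>
  have "Polynomial.coeff (line u v (c_poly n I J A)) 1 =
      - A * Polynomial.coeff (line u v (cyc_cofactor n I)) 1 * u I * u (n - I)"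
    unfolding c_poly_def const_poly_hom.eval_diff const_poly_hom.eval_mult
      Polynomial.coeff_diff coeff_1_mult coeff_mult_0 coeff_0_line
    using uv by simp
  then show ?thesis
    using uv A by (intro exI[of _ u] exI[of _ v]) (simp add: a_poly_def b_poly_def c_poly_def)
next
  case True
  have J3: "3 * J = n \<or> 3 * J = 2 * n"
  proof -
    obtain k where k: "3 * J = n * k" using True by (auto simp: dvd_def)
    have "n * k < n * 3" "0 < n * k" using IJ unfolding k[symmetric] by auto
    then have "k = 1 \<or> k = 2" by auto
    then show ?thesis using k by auto
  qed
  \<comment> \<open>As 2 I < n, 3 I = 0 modulo n would mean I = n/3, and then J, being n/3 or 2n/3,
    would be I or n - I.\<close>
  have "\<not> n dvd 3 * I"
  proof
    assume "n dvd 3 * I"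
    then obtain k where k: "3 * I = n * k" by (auto simp: dvd_def)
    have "n * k < n * 2" "0 < n * k" using IJ unfolding k[symmetric] by auto
    then have "k = 1" by auto
    then show False using k J3 IJ by auto
  qed
  moreover have "2 * J \<noteq> n" using J3 n by auto
  ultimately obtain u v :: "nat \<Rightarrow> 'k" where uv: "u I = 0" "u (n - I) = 0" "u J \<noteq> 0" "u (n - J) \<noteq> 0"
    "mpol_eval (\<lambda>c. c) u (cyc_cofactor n I) \<noteq> 0" "mpol_eval (\<lambda>c. c) u (cyc_cofactor n J) = 0"
    "Polynomial.coeff (line u v (cyc_cofactor n J)) 1 \<noteq> 0"
    using cofactor_simple_zero[OF inf n, of J I] IJ by (auto simp: add.commute)
  have "Polynomial.coeff (line u v (c_poly n I J A)) 1 =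
      Polynomial.coeff (line u v (cyc_cofactor n J)) 1 * u J * u (n - J)"
    unfolding c_poly_def const_poly_hom.eval_diff const_poly_hom.eval_mult
      Polynomial.coeff_diff coeff_1_mult coeff_mult_0 coeff_0_line
    using uv by simp
  then show ?thesis
    using uv A by (intro exI[of _ u] exI[of _ v]) (simp add: a_poly_def b_poly_def c_poly_def)
qed

section \<open>Irreducibility\<close>

lemma Var_not_in_mpolys: "i \<notin> V \<Longrightarrow> Var i \<notin> mpolys V"
  by (simp add: Var_def mpolys_def)

text \<open>Reduction modulo X_i - r is a substitution with values in an integral domain.\<close>

lemma prime_elem_Var_diff:
  fixes r :: "'a::idom mpol"
  assumes "r \<in> mpolys (- {i})"
  shows "prime_elem (Var i - r)"
proof (rule prime_elemI)
  show "Var i - r \<noteq> 0" using assms Var_not_in_mpolys[of i "- {i}"] by auto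
qed (auto simp: dvd_iff_subst_eq_0[OF assms])

text \<open>The primes are removed one at a time: \<open>p x\<close> divides \<open>g * s\<close>
  but not \<open>g\<close>, hence divides \<open>s\<close> and cancels.\<close>

lemma dvd_cancel_prime_prod:
  fixes g t :: "'a::idom"
  assumes "finite S" "\<And>l. l \<in> S \<Longrightarrow> prime_elem (p l)" "\<And>l. l \<in> S \<Longrightarrow> \<not> p l dvd g"
    "g dvd prod p S * t"
  shows "g dvd t"
  using assms
proof (induction S rule: finite_induct)
  case (insert x S)
  obtain s where s: "p x * (prod p S * t) = g * s"
    using insert.prems(3) insert.hyps by (auto simp: dvd_def mult.assoc)
  then have "p x dvd g * s" by (metis dvd_triv_left)
  then have "p x dvd s"
    using insert.prems(1,2)[of x] by (simp add: prime_elem_dvd_mult_iff)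
  then obtain s' where "s = p x * s'" by (auto simp: dvd_def)
  then have "p x * (prod p S * t) = p x * (g * s')" using s by (simp add: mult_ac)
  then have "prod p S * t = g * s'"
    using insert.prems(1)[of x] by (simp add: prime_elem_def)
  then show ?case using insert by auto
qed simp

text \<open>Contracting an I-edge collapses no J-edge, because J is neither I nor -I modulo n. Thus
  no prime factor of G divides H.\<close>

lemma subst_cofactor_ne_0:
  fixes n I J l :: nat
  assumes "0 < I" "I < n" "0 < J" "J < n" "I \<noteq> J" "I + J \<noteq> n" "l \<in> {1..<n} - {n - I}"
  shows "mpol_eval Const (Var(l := Var ((l + I) mod n))) (cyc_cofactor n J :: 'a::idom mpol) \<noteq> 0"
proof -
  let ?s = "\<lambda>k. if k = l then (l + I) mod n else k"
  have "?s k \<noteq> ?s ((k + J) mod n)" if k: "k \<in> {1..<n} - {n - J}" for k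
  proof -
    have k': "(k + J) mod n \<noteq> k" by (rule edge_mod_range(2)[OF assms(3,4) k])
    have "(l + I) mod n \<noteq> (l + J) mod n"
    proof -
      have "l < n" using assms(7) by simp
      then show ?thesis using assms(2,4,5) by (auto simp: mod_add_less)
    qed
    moreover have "k \<noteq> ((k + J) mod n + I) mod n"
    proof -
      have "k < n" "(k + J) mod n < n" using k by simp_all
      then show ?thesis using assms(1-4,6) by (auto simp: mod_add_less)
    qed
    ultimately show ?thesis using k' by auto
  qed
  then have "(Var (?s k) :: 'a mpol) - Var (?s ((k + J) mod n)) \<noteq> 0"
    if "k \<in> {1..<n} - {n - J}" for k
    using that by (simp add: Var_eq_iff)
  moreover have "(Var(l := Var ((l + I) mod n))) k = (Var (?s k) :: 'a mpol)" for k by simp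
  ultimately show ?thesis
    unfolding cyc_cofactor_explicit(3)[OF assms(3,4)]
    by (simp del: One_nat_def fun_upd_apply)
qed

text \<open>A common divisor divides \<open>A G (X\<^sub>I + X\<^sub>n\<^sub>-\<^sub>I - X\<^sub>J - X\<^sub>n\<^sub>-\<^sub>J)\<close> and
  \<open>A G (X\<^sub>J X\<^sub>n\<^sub>-\<^sub>J - X\<^sub>I X\<^sub>n\<^sub>-\<^sub>I)\<close>, but no prime factor of \<open>G\<close> divides it. The remaining linear form is
  prime, and modulo it the quadric becomes \<open>(X\<^sub>J - X\<^sub>n\<^sub>-\<^sub>I) (X\<^sub>n\<^sub>-\<^sub>J - X\<^sub>n\<^sub>-\<^sub>I)\<close>.\<close>

lemma common_divisor_is_unit:
  fixes A :: "'a::field" and g :: "'a mpol"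
  assumes IJ: "0 < I" "I < J" "J < n" "2 * I < n" "I + J \<noteq> n" and A: "A \<noteq> 0"
    and g: "g dvd a_poly n I J A" "g dvd b_poly n I J A" "g dvd c_poly n I J A"
  shows "g dvd 1"
proof -
  have I: "0 < I" "I < n" and J: "0 < J" "J < n" using IJ by auto
  define G H :: "'a mpol" where "G = cyc_cofactor n I" and "H = cyc_cofactor n J"
  define S where "S = {1..<n} - {n - I}"
  define e :: "nat \<Rightarrow> 'a mpol" where "e l = Var l - Var ((l + I) mod n)" for l
  have G: "G = prod e S"
    unfolding G_def e_def S_def by (rule cyc_cofactor_explicit(3)[OF I])
  have inv: "Const (inverse A) * (Const A * x) = x" for x
    using A by (simp add: Const_hom.hom_mult[symmetric] mult.assoc[symmetric] Const_hom.hom_1)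
  have cancel: "g dvd x" if "g dvd Const A * x" for x
    using dvd_mult[OF that, of "Const (inverse A)"] by (simp only: inv)
  have mem: "Var ((l + I) mod n) \<in> mpolys (- {l})" if "l \<in> S" for l
    using edge_mod_range[OF I] that by (intro Var_in_mpolys) (auto simp: S_def)
  have prime: "prime_elem (e l)" if "l \<in> S" for l
    unfolding e_def by (rule prime_elem_Var_diff[OF mem[OF that]])
  \<comment> \<open>\<open>e l\<close> divides G, so if it also divided a = H - A G, it would divide
    H.\<close>
  have ndvd: "\<not> e l dvd g" if l: "l \<in> S" for l
  proof
    assume "e l dvd g"
    then have "e l dvd H - Const A * G"
      using g(1) unfolding a_poly_def G_def H_def by (rule dvd_trans)
    moreover have "e l dvd Const A * G"
      using l unfolding G by (intro dvd_mult dvd_prodI) (auto simp: S_def)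
    ultimately have "e l dvd (H - Const A * G) + Const A * G" by (rule dvd_add)
    then have "e l dvd H" by simp
    then show False
      using subst_cofactor_ne_0[OF I J, of l] IJ l
      unfolding e_def dvd_iff_subst_eq_0[OF mem[OF l]] H_def S_def by auto
  qed
  have cancel_prod: "g dvd x" if "g dvd prod e S * x" for x
    by (rule dvd_cancel_prime_prod[OF _ prime ndvd that]) (simp add: S_def)
  define r :: "'a mpol" where "r = Var J + Var (n - J) - Var (n - I)"
  define Q :: "'a mpol" where "Q = Var J * Var (n - J) - Var I * Var (n - I)"
  have "g dvd b_poly n I J A + a_poly n I J A * (Var J + Var (n - J))"
    using g by auto
  also have "\<dots> = Const A * (prod e S * (Var I - r))"
    unfolding a_poly_def b_poly_def r_def G_def[symmetric] H_def[symmetric] G[symmetric]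
    by (simp add: algebra_simps)
  finally have "g dvd prod e S * (Var I - r)" by (rule cancel)
  then have gL: "g dvd Var I - r" by (rule cancel_prod)
  have "g dvd c_poly n I J A - a_poly n I J A * (Var J * Var (n - J))"
    using g by auto
  also have "\<dots> = Const A * (prod e S * Q)"
    unfolding a_poly_def c_poly_def Q_def G_def[symmetric] H_def[symmetric] G[symmetric]
    by (simp add: algebra_simps)
  finally have "g dvd prod e S * Q" by (rule cancel)
  then have gQ: "g dvd Q" by (rule cancel_prod)
  have r: "r \<in> mpolys (- {I})"
    unfolding r_def using IJ by (intro mpolys_diff mpolys_add Var_in_mpolys) auto
  obtain s where s: "Var I - r = g * s" using gL by (auto simp: dvd_def)
  have L: "prime_elem (Var I - r)" by (rule prime_elem_Var_diff[OF r])
  have "\<not> (Var I - r) dvd Q"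
  proof
    assume "(Var I - r) dvd Q"
    then have "mpol_eval Const (Var(I := r)) Q = 0" unfolding dvd_iff_subst_eq_0[OF r] .
    moreover have "n - J \<noteq> I" "n - I \<noteq> I" "J \<noteq> I" using IJ by auto
    ultimately have "(Var J - Var (n - I)) * (Var (n - J) - Var (n - I)) = (0 :: 'a mpol)"
      by (simp add: Q_def r_def algebra_simps)
    then show False using IJ by (auto simp: Var_eq_iff)
  qed
  \<comment> \<open>The prime X_I - r = g s does not divide \<open>g\<close>, so it divides
    \<open>s\<close> and cancels, leaving \<open>g\<close> a unit.\<close>
  then have "\<not> (Var I - r) dvd g" using gQ dvd_trans by blast
  then have "(Var I - r) dvd s"
    using L s prime_elem_dvd_mult_iff[OF L, of g s] by simp
  then obtain t where "s = (Var I - r) * t" by (auto simp: dvd_def)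
  then have "(Var I - r) * 1 = (Var I - r) * (g * t)" using s by (simp add: mult_ac)
  then have "1 = g * t" using L unfolding prime_elem_def by (metis mult_left_cancel)
  then show ?thesis by (rule dvdI)
qed

text \<open>Substituting \<open>X\<^sub>j := X\<^sub>j\<^sub>+\<^sub>J\<close> for some \<open>j \<notin> {0, n - J, I, n - I}\<close> kills \<open>H\<close> but neither \<open>G\<close> nor
  \<open>X\<^sub>I + X\<^sub>n\<^sub>-\<^sub>I\<close>.\<close>

lemma b_poly_ne_0:
  fixes A :: "'a::field"
  assumes n: "n \<ge> 5" and IJ: "0 < I" "I < J" "J < n" "2 * I < n" "I + J \<noteq> n" and A: "A \<noteq> 0"
  shows "b_poly n I J A \<noteq> 0"
proof
  assume b: "b_poly n I J A = 0"
  have I: "0 < I" "I < n" and J: "0 < J" "J < n" using IJ by auto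
  \<comment> \<open>0 and n - J start no factor of H; avoiding I and n - I keeps X_I + X_(n-I)
    fixed.\<close>
  define T where "T = {0, n - J, I, n - I}"
  have "card T < card {0..<n}"
    using card_length[of "[0, n - J, I, n - I]"] n by (simp add: T_def)
  then have "\<not> {0..<n} \<subseteq> T"
    using card_mono[of T "{0..<n}"] by (auto simp: T_def)
  then obtain j where "j < n" "j \<notin> T" by force
  then have j: "j < n" "j \<notin> {0, n - J, I, n - I}" by (simp_all add: T_def)
  then have j': "j \<in> {1..<n} - {n - J}" by auto
  let ?f = "Var(j := Var ((j + J) mod n)) :: nat \<Rightarrow> 'a mpol"
  have "Var j - Var ((j + J) mod n) dvd (cyc_cofactor n J :: 'a mpol)"
    unfolding cyc_cofactor_explicit(3)[OF J] using j' by (intro dvd_prodI) auto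
  moreover have "(Var ((j + J) mod n) :: 'a mpol) \<in> mpolys (- {j})"
    using edge_mod_range[OF J j'] by (intro Var_in_mpolys) auto
  ultimately have H: "mpol_eval Const ?f (cyc_cofactor n J) = 0"
    by (simp add: dvd_iff_subst_eq_0)
  have G: "mpol_eval Const ?f (cyc_cofactor n I) \<noteq> 0"
    using subst_cofactor_ne_0[OF J I _ _ j'] IJ by auto
  have A': "Const A \<noteq> 0" using A by (metis Const_def lookup_single_eq lookup_zero)
  \<comment> \<open>The coefficient of X_I is 1 in every characteristic, 2 included, since I and n -
    I differ.\<close>
  have "Poly_Mapping.lookup (Var I + Var (n - I) :: 'a mpol) (Poly_Mapping.single I 1) = 1"
  proof -
    have "Poly_Mapping.single (n - I) (1::nat) \<noteq> Poly_Mapping.single I 1"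
    proof
      assume "Poly_Mapping.single (n - I) (1::nat) = Poly_Mapping.single I 1"
      from arg_cong[OF this, of Poly_Mapping.keys] show False using IJ by simp
    qed
    then show ?thesis by (simp add: Var_def lookup_add lookup_single when_def)
  qed
  then have "Var I + Var (n - I) \<noteq> (0 :: 'a mpol)" by (metis lookup_zero zero_neq_one)
  moreover have "mpol_eval Const ?f (b_poly n I J A) =
      Const A * mpol_eval Const ?f (cyc_cofactor n I) * (Var I + Var (n - I))"
    using H j by (simp add: b_poly_def)
  ultimately show False using b G A' by simp
qed

section \<open>P as a quadratic in X_0, and its factorisations\<close>

text \<open>The other variables stay in the coefficients, so \<open>Polynomial.degree\<close>
  measures the degree in X_0.\<close>

definition in_Var_0 :: "'a::comm_ring_1 mpol \<Rightarrow> 'a mpol poly" where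
  "in_Var_0 = mpol_eval (\<lambda>c. [:Const c:]) (\<lambda>i. if i = 0 then [:0, 1:] else [:Var i:])"

lemma in_Var_0_mult: "in_Var_0 (p * q) = in_Var_0 p * in_Var_0 q"
  and in_Var_0_add: "in_Var_0 (p + q) = in_Var_0 p + in_Var_0 q"
  and in_Var_0_one: "in_Var_0 1 = 1"
  and in_Var_0_Var_0: "in_Var_0 (Var 0) = [:0, 1:]"
  by (simp_all add: in_Var_0_def)

lemma in_Var_0_const:
  assumes "p \<in> mpolys V" "0 \<notin> V"
  shows "in_Var_0 p = [:p:]"
proof -
  have "in_Var_0 p = mpol_eval (\<lambda>c. [:Const c:]) (\<lambda>i. [:Var i:]) p"
    unfolding in_Var_0_def by (rule mpol_eval_eq_on_mpolys[OF assms(1)]) (use assms(2) in \<open>auto intro: gr0I\<close>)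
  also have "\<dots> = [:p:]"
    by (induction p rule: mpol_induct) simp_all
  finally show ?thesis .
qed

lemma poly_in_Var_0: "poly (in_Var_0 p) (Var 0) = p"
  unfolding in_Var_0_def by (induction p rule: mpol_induct) simp_all

lemma irreducible_P_poly:
  fixes A :: "'a::field"
  assumes IJ: "0 < I" "I < J" "J < n" "2 * I < n" "I + J \<noteq> n" and A: "A \<noteq> 0"
    and u: "mpol_eval (\<lambda>c. c) u (a_poly n I J A) \<noteq> 0" "mpol_eval (\<lambda>c. c) u (b_poly n I J A) = 0"
      "mpol_eval (\<lambda>c. c) u (c_poly n I J A) = 0" "Polynomial.coeff (line u v (c_poly n I J A)) 1 \<noteq> 0"
  shows "irreducible_in (mpolys {0..n-1}) (P_poly n I J A)"
proof -
  have I: "0 < I" "I < n" and J: "0 < J" "J < n" using IJ by auto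
  define a b c where abc: "a = a_poly n I J A" "b = b_poly n I J A" "c = c_poly n I J A"
  note G = cyc_cofactor(1)[OF I, where ?'a = 'a] and H = cyc_cofactor(1)[OF J, where ?'a = 'a]
  have "a \<in> mpolys {1..n-1}" "b \<in> mpolys {1..n-1}" "c \<in> mpolys {1..n-1}"
    unfolding abc a_poly_def b_poly_def c_poly_def using IJ
    by (intro mpolys_diff mpolys_mult mpolys_add G H Const_in_mpolys Var_in_mpolys; auto)+
  then have abc_const: "in_Var_0 a = [:a:]" "in_Var_0 b = [:b:]" "in_Var_0 c = [:c:]"
    by (auto intro!: in_Var_0_const)
  have P: "in_Var_0 (P_poly n I J A) = [:c, b, a:]"
    unfolding P_poly_quadratic[OF I J] abc[symmetric]
    by (simp add: in_Var_0_mult in_Var_0_add in_Var_0_Var_0 abc_const power2_eq_square)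
  have a: "a \<noteq> 0" using u(1) unfolding abc by auto
  have mem: "P_poly n I J A \<in> mpolys {0..n-1}"
  proof -
    have "(cyc_prod n K :: 'a mpol) \<in> mpolys {0..n-1}" for K
      unfolding cyc_prod_def using J mod_less_divisor[of n]
      by (intro mpolys_prod mpolys_diff Var_in_mpolys) (auto simp: less_eq_Suc_le le_diff_conv2)
    then show ?thesis
      unfolding P_poly_def by (intro mpolys_diff mpolys_mult Const_in_mpolys)
  qed
  \<comment> \<open>A factor of degree 0 in X_0 divides each of a, b and c.\<close>
  have content: "x dvd 1" if P_eq: "P_poly n I J A = x * y" and deg: "Polynomial.degree (in_Var_0 x) = 0"
    for x y
  proof -
    obtain g where g: "in_Var_0 x = [:g:]" using degree_eq_zeroE[OF deg] by blast
    then have "x = g" using poly_in_Var_0[of x] by simp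
    have "[:c, b, a:] = Polynomial.smult g (in_Var_0 y)"
      using arg_cong[OF P_eq, of in_Var_0] P g by (simp add: in_Var_0_mult)
    then have "Polynomial.coeff [:c, b, a:] k = g * Polynomial.coeff (in_Var_0 y) k" for k
      by simp
    from this[of 0] this[of 1] this[of 2] have "g dvd a" "g dvd b" "g dvd c"
      by (simp_all add: numeral_2_eq_2)
    then show ?thesis
      using common_divisor_is_unit[OF IJ A] \<open>x = g\<close> unfolding abc by blast
  qed
  have "x dvd 1 \<or> y dvd 1" if P_eq: "P_poly n I J A = x * y" for x y
  proof -
    have xy: "in_Var_0 x * in_Var_0 y = [:c, b, a:]"
      using arg_cong[OF P_eq, of in_Var_0] P by (simp add: in_Var_0_mult)
    then have "in_Var_0 x * in_Var_0 y \<noteq> 0" using a by simp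
    then have "Polynomial.degree (in_Var_0 x) + Polynomial.degree (in_Var_0 y) = 2"
      using xy a degree_mult_eq[of "in_Var_0 x" "in_Var_0 y"] by force
    then consider "Polynomial.degree (in_Var_0 x) = 0" | "Polynomial.degree (in_Var_0 y) = 0"
      | "Polynomial.degree (in_Var_0 x) = 1" "Polynomial.degree (in_Var_0 y) = 1"
      by linarith
    then show ?thesis
    proof cases
      case 1
      then show ?thesis using content[OF P_eq] by simp
    next
      case 2
      then show ?thesis using content[of y x] P_eq by (simp add: mult.commute)
    next
      case 3
      then obtain \<alpha> \<beta> \<gamma> \<delta> where lin: "in_Var_0 x = [:\<beta>, \<alpha>:]" "in_Var_0 y = [:\<delta>, \<gamma>:]"
        by (meson degree1_coeffs)
      then have eqs: "c = \<beta> * \<delta>" "b = \<beta> * \<gamma> + \<alpha> * \<delta>" "a = \<alpha> * \<gamma>"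
        using xy by (simp_all add: algebra_simps)
      let ?e = "mpol_eval (\<lambda>c. c) u"
      \<comment> \<open>At \<open>u\<close>, \<alpha> \<gamma> = a is nonzero while \<beta> \<delta>
        and \<beta> \<gamma> + \<alpha> \<delta> vanish: if one of \<beta>, \<delta> is 0, so is the
        other.\<close>
      have "?e \<beta> = 0 \<and> ?e \<delta> = 0"
        using u(1-3) unfolding abc[symmetric] eqs by auto
      \<comment> \<open>A product of two factors vanishing at \<open>u\<close> has no linear term in
        t.\<close>
      then have "Polynomial.coeff (line u v c) 1 = 0"
        unfolding eqs const_poly_hom.eval_mult coeff_1_mult coeff_0_line by simp
      then show ?thesis using u(4) unfolding abc by simp
    qed
  qed
  then have "\<forall>x\<in>mpolys {0..n-1}. \<forall>y\<in>mpolys {0..n-1}. P_poly n I J A = x * y \<longrightarrow>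
      (\<exists>s\<in>mpolys {0..n-1}. x * s = 1) \<or> (\<exists>s\<in>mpolys {0..n-1}. y * s = 1)"
    using inverse_in_mpolys by blast
  moreover have "P_poly n I J A \<noteq> 0"
    using P a by (auto simp: in_Var_0_def)
  \<comment> \<open>A unit would have degree 0 in X_0, but a is nonzero.\<close>
  moreover have "P_poly n I J A * s \<noteq> 1" for s
  proof
    assume "P_poly n I J A * s = 1"
    then have "[:c, b, a:] * in_Var_0 s = 1"
      using P by (metis in_Var_0_mult in_Var_0_one)
    then have "[:c, b, a:] dvd 1" by (metis dvd_triv_left)
    then show False using a by (auto simp: is_unit_poly_iff)
  qed
  ultimately show ?thesis using mem unfolding irreducible_in_def by blast
qed

section \<open>Conclusion over the algebraic closure\<close>

lemma infinite_UNIV_alg_closed: "infinite (UNIV :: 'a::alg_closed_field set)"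
proof
  assume fin: "finite (UNIV :: 'a set)"
  \<comment> \<open>If the field were finite, \<open>p\<close> would take the value 1 everywhere and
    have no root.\<close>
  define p where "p = (\<Prod>x\<in>(UNIV::'a set). [:- x, 1:]) + 1"
  have "poly p x = 1" for x
    using fin by (auto simp: p_def poly_prod)
  moreover have "Polynomial.degree p > 0"
  proof -
    have "Polynomial.degree (\<Prod>x\<in>(UNIV::'a set). [:- x, 1:]) = card (UNIV :: 'a set)"
      by (subst degree_prod_eq_sum_degree) auto
    moreover have "card (UNIV :: 'a set) > 0" using fin by (simp add: card_gt_0_iff)
    ultimately show ?thesis unfolding p_def by (subst degree_add_eq_left) simp_all
  qed
  ultimately show False using alg_closed_imp_poly_has_root[of p] by auto
qed

theorem theorem3p8:
  fixes q n I J :: nat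
    and A :: "'a::{field,finite}"
  assumes "primepow q" and "card (UNIV :: 'a set) = q"
    and "n \<ge> 5"
    and "0 < I" and "I < J" and "J < n" and "2 * I < n"
    and "I + J \<noteq> n" and "gcd n (J - I) = 1"
    and "A \<noteq> 0"
  shows "(\<exists>(u :: nat \<Rightarrow> 'a alg_closure) m1 m2.
            has_multiplicity (a_poly n I J (to_ac A) * c_poly n I J (to_ac A)) u m1 \<and>
            m1 \<ge> 1 \<and> odd m1 \<and>
            has_multiplicity (b_poly n I J (to_ac A)) u m2 \<and>
            m2 \<ge> 1 \<and> 2 * m2 > m1) \<and>
         irreducible_in (mpolys {0..n-1}) (P_poly n I J (to_ac A))"
proof
  let ?a = "a_poly n I J (to_ac A)" and ?b = "b_poly n I J (to_ac A)" and ?c = "c_poly n I J (to_ac A)"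
  note IJ = \<open>0 < I\<close> \<open>I < J\<close> \<open>J < n\<close> \<open>2 * I < n\<close> \<open>I + J \<noteq> n\<close>
  have A: "to_ac A \<noteq> 0" using \<open>A \<noteq> 0\<close> by simp
  obtain u v where u: "mpol_eval (\<lambda>c. c) u ?a \<noteq> 0" "mpol_eval (\<lambda>c. c) u ?b = 0"
    "mpol_eval (\<lambda>c. c) u ?c = 0" "Polynomial.coeff (line u v ?c) 1 \<noteq> 0"
    using ex_branch_point[OF infinite_UNIV_alg_closed \<open>n \<ge> 5\<close> IJ A] by blast
  \<comment> \<open>As c(u) = 0, the linear coefficient of a c is a(u) times that of c.\<close>
  have "Polynomial.coeff (line u v (?a * ?c)) 1 \<noteq> 0"
    unfolding const_poly_hom.eval_mult coeff_1_mult coeff_0_line using u by simp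
  then have "has_multiplicity (?a * ?c) u 1"
    using u by (intro has_multiplicity_1I) simp_all
  \<comment> \<open>With m_1 = 1, every m_2 of at least 1 satisfies 2 m_2 > m_1.\<close>
  moreover obtain k where "k \<ge> 1" "has_multiplicity ?b u k"
    using ex_has_multiplicity[OF b_poly_ne_0[OF \<open>n \<ge> 5\<close> IJ A] u(2)] by blast
  ultimately show "\<exists>(u :: nat \<Rightarrow> 'a alg_closure) m1 m2.
      has_multiplicity (?a * ?c) u m1 \<and> m1 \<ge> 1 \<and> odd m1 \<and> has_multiplicity ?b u m2 \<and>
      m2 \<ge> 1 \<and> 2 * m2 > m1"
    by (intro exI[of _ u] exI[of _ 1] exI[of _ k]) auto
  show "irreducible_in (mpolys {0..n-1}) (P_poly n I J (to_ac A))"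
    by (rule irreducible_P_poly[OF IJ A u])
qed

end
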